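(* Let $R$ be a finite local commutative ring with identity. Then the unit-zero divisor graph $G_{UZ}(R)$ is an Eulerian graph if and only if both $|R|$ and $|U(R)|$ are even.
   Context: For a finite commutative ring $R$ with identity, $U(R)$ is the set of units and $Z(R)$ is the set of zero divisors, with the convention $0\in Z(R)$. The unit-zero divisor graph $G_{UZ}(R)$ is the simple undirected graph whose vertex set is the set of all elements of $R$, where two distinct vertices $u,v$ are adjacent if and only if $u+v\in U(R)$ and $uv\in Z(R)$. A commutative ring with identity is local if it has a unique maximal ideal. A graph is Eulerian if it is a nontrivial connected graph having an Eulerian circuit (a closed trail using every edge exactly once). *)

theory Defs
  imports "HOL-Algebra.Algebra"
begin

text \<open>
  A simple undirected graph is given by a vertex set \<open>V\<close> and a set \<open>E\<close> of two-element subsets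
  of \<open>V\<close>. A walk is the list of its successive vertices; in a simple graph this
  determines the edges traversed; the one-element list is the walk of length zero.
\<close>

definition walk_edges :: "'a list \<Rightarrow> 'a set list" where
  "walk_edges vs = map (\<lambda>(u, v). {u, v}) (zip vs (tl vs))"

definition graph_walk :: "'a set \<Rightarrow> 'a set set \<Rightarrow> 'a list \<Rightarrow> bool" where
  "graph_walk V E vs \<longleftrightarrow> vs \<noteq> [] \<and> set vs \<subseteq> V \<and> set (walk_edges vs) \<subseteq> E"

definition graph_connected :: "'a set \<Rightarrow> 'a set set \<Rightarrow> bool" where
  "graph_connected V E \<longleftrightarrow>
     (\<forall>u\<in>V. \<forall>v\<in>V. \<exists>vs. graph_walk V E vs \<and> hd vs = u \<and> last vs = v)"

definition closed_trail :: "'a set \<Rightarrow> 'a set set \<Rightarrow> 'a list \<Rightarrow> bool" where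
  "closed_trail V E vs \<longleftrightarrow> graph_walk V E vs \<and> hd vs = last vs \<and> distinct (walk_edges vs)"

definition eulerian_circuit :: "'a set \<Rightarrow> 'a set set \<Rightarrow> 'a list \<Rightarrow> bool" where
  "eulerian_circuit V E vs \<longleftrightarrow> closed_trail V E vs \<and> set (walk_edges vs) = E"

text \<open>Nontrivial means having at least two vertices.\<close>

definition eulerian_graph :: "'a set \<Rightarrow> 'a set set \<Rightarrow> bool" where
  "eulerian_graph V E \<longleftrightarrow>
     (\<exists>u\<in>V. \<exists>v\<in>V. u \<noteq> v) \<and> graph_connected V E \<and> (\<exists>vs. eulerian_circuit V E vs)"

text \<open>The zero ring has no maximal ideal, so a local ring is automatically nonzero.\<close>

locale local_cring = cring +
  assumes unique_maximalideal: "\<exists>!M. maximalideal M R"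

text \<open>By convention, zero is a zero divisor in every ring, including the zero ring.\<close>

definition zero_divisors :: "('a, 'b) ring_scheme \<Rightarrow> 'a set" where
  "zero_divisors R =
     insert \<zero>\<^bsub>R\<^esub> {x \<in> carrier R. \<exists>y\<in>carrier R. y \<noteq> \<zero>\<^bsub>R\<^esub> \<and> x \<otimes>\<^bsub>R\<^esub> y = \<zero>\<^bsub>R\<^esub>}"

text \<open>The edge set of the unit-zero divisor graph, whose vertex set is \<^term>\<open>carrier R\<close>.\<close>

definition uz_edges :: "('a, 'b) ring_scheme \<Rightarrow> 'a set set" where
  "uz_edges R = {{u, v} | u v. u \<in> carrier R \<and> v \<in> carrier R \<and> u \<noteq> v \<and>
     u \<oplus>\<^bsub>R\<^esub> v \<in> Units R \<and> u \<otimes>\<^bsub>R\<^esub> v \<in> zero_divisors R}"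

end

theory Submission
  imports Defs
begin

text \<open>
  In a finite local ring the non-units are exactly the zero divisors and form the maximal ideal.
  Hence \<open>u v\<close> is a zero divisor iff one of \<open>u\<close>, \<open>v\<close> is a non-unit, and then \<open>u + v\<close> is a unit iff
  the other one is a unit: the graph is complete bipartite between non-units and units. A complete
  bipartite graph with nonempty parts is Eulerian iff both parts are even. Necessity is the parity
  of degrees; for sufficiency, split one part into pairs: each pair together with the
  other part carries a closed trail through a common base vertex, and these trails are concatenated.
\<close>

section \<open>Walks\<close>

lemma walk_edges_simps [simp]:
  "walk_edges [] = []"
  "walk_edges [x] = []"
  "walk_edges (x # y # zs) = {x, y} # walk_edges (y # zs)"
  by (simp_all add: walk_edges_def)

lemma length_walk_edges [simp]: "length (walk_edges vs) = length vs - 1"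
  by (simp add: walk_edges_def)

text \<open>Cutting a walk at \<open>b\<close> keeps \<open>b\<close> in both pieces, so no edge is
  lost; this is what joins closed trails at a common vertex.\<close>

lemma walk_edges_append:
  "walk_edges (xs @ b # ys) = walk_edges (xs @ [b]) @ walk_edges (b # ys)"
  by (induction xs rule: induct_list012) auto

text \<open>Prepending an edge \<open>{x, y}\<close> changes the parity exactly when one of
  \<open>x\<close>, \<open>y\<close> is \<open>v\<close>, that is, when the truth of
  \<open>hd vs = v\<close> changes. A loop \<open>{v}\<close> would be counted once without changing
  the head, hence the ban on singletons.\<close>

lemma even_incident_edges_closed_walk:
  assumes "vs \<noteq> []" and "\<And>u. {u} \<notin> set (walk_edges vs)"
  shows "even (length (filter ((\<in>) v) (walk_edges vs))) \<longleftrightarrow> (hd vs = v \<longleftrightarrow> last vs = v)"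
  using assms
proof (induction vs rule: induct_list012)
  case (3 x y zs)
  have "x \<noteq> y"
    using "3.prems"(2)[of x] by auto
  then show ?case
    using 3 by auto
qed auto

lemma eulerian_circuit_even_degree:
  assumes "eulerian_circuit V E vs" and "\<And>u. {u} \<notin> E"
  shows "even (card {e \<in> E. v \<in> e})"
proof -
  have vs: "vs \<noteq> []" "hd vs = last vs" "distinct (walk_edges vs)" "set (walk_edges vs) = E"
    using assms(1) by (auto simp: eulerian_circuit_def closed_trail_def graph_walk_def)
  have "card {e \<in> E. v \<in> e} = length (filter ((\<in>) v) (walk_edges vs))"
    using distinct_card[OF distinct_filter[OF vs(3)], of "(\<in>) v"] vs(4) by simp
  then show ?thesis
    using even_incident_edges_closed_walk[OF vs(1), of v] vs(2,4) assms(2) by simp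
qed

section \<open>Complete bipartite graphs\<close>

definition bip_edges :: "'a set \<Rightarrow> 'a set \<Rightarrow> 'a set set" where
  "bip_edges A B = (\<lambda>(a, b). {a, b}) ` (A \<times> B)"

lemma bip_edges_commute: "bip_edges A B = bip_edges B A"
  by (auto simp: bip_edges_def image_iff insert_commute)

lemma bip_edges_insert: "bip_edges (insert a A) B = (\<lambda>b. {a, b}) ` B \<union> bip_edges A B"
  by (auto simp: bip_edges_def image_iff)

text \<open>Disjoint sides make the ordered pair recoverable from the edge. The count later
  certifies that a covering walk repeats no edge.\<close>

lemma card_bip_edges:
  assumes "A \<inter> B = {}"
  shows "card (bip_edges A B) = card A * card B"
proof -
  have "inj_on (\<lambda>(a, b). {a, b}) (A \<times> B)"
    using assms by (auto simp: inj_on_def doubleton_eq_iff)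
  then show ?thesis
    by (simp add: bip_edges_def card_image card_cartesian_product)
qed

lemma bip_degree:
  assumes "A \<inter> B = {}" and "a \<in> A"
  shows "card {e \<in> bip_edges A B. a \<in> e} = card B"
proof -
  have "{e \<in> bip_edges A B. a \<in> e} = (\<lambda>b. {a, b}) ` B"
    using assms by (auto simp: bip_edges_def)
  moreover have "inj_on (\<lambda>b. {a, b}) B"
    by (auto simp: inj_on_def doubleton_eq_iff)
  ultimately show ?thesis
    by (simp add: card_image)
qed

text \<open>For an even list of distinct vertices this is the tour b1, a, b2, a', b3, a, b4, a',
  ...; returning to b1 at the end makes it a closed trail joining \<open>a\<close> and
  \<open>a'\<close> to every entry. A leftover entry of an odd list is dropped.\<close>

fun zigzag :: "'a \<Rightarrow> 'a \<Rightarrow> 'a list \<Rightarrow> 'a list" where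
  "zigzag a a' (x # y # bs) = x # a # y # a' # zigzag a a' bs"
| "zigzag a a' _ = []"

lemma length_zigzag: "even (length bs) \<Longrightarrow> length (zigzag a a' bs) = 2 * length bs"
  by (induction a a' bs rule: zigzag.induct) auto

lemma set_zigzag: "set (zigzag a a' bs) \<subseteq> {a, a'} \<union> set bs"
  by (induction a a' bs rule: zigzag.induct) auto

lemma hd_zigzag: "even (length bs) \<Longrightarrow> bs \<noteq> [] \<Longrightarrow> hd (zigzag a a' bs) = hd bs"
  by (induction a a' bs rule: zigzag.induct) auto

lemma zigzag_eq_Nil: "even (length bs) \<Longrightarrow> zigzag a a' bs = [] \<longleftrightarrow> bs = []"
  by (induction a a' bs rule: zigzag.induct) auto

text \<open>The closing vertex \<open>c\<close> is kept arbitrary because the head of the list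
  changes along the recursion; the tour closes for \<open>c = hd bs\<close>.\<close>

lemma set_walk_edges_zigzag:
  assumes "even (length bs)" and "bs \<noteq> []"
  shows "set (walk_edges (zigzag a a' bs @ [c])) =
    (\<lambda>b. {a, b}) ` set bs \<union> (\<lambda>b. {a', b}) ` insert c (set (tl bs))"
  using assms
proof (induction a a' bs rule: zigzag.induct)
  case (1 a a' x y bs)
  show ?case
  proof (cases "bs = []")
    case False
    with 1 obtain zs where zs: "zigzag a a' bs = hd bs # zs"
      using hd_zigzag[of bs a a'] zigzag_eq_Nil[of bs a a'] by (cases "zigzag a a' bs") auto
    \<comment> \<open>The link from \<open>a'\<close> to \<open>hd bs\<close> supplies the neighbour
      of \<open>a'\<close> that the induction hypothesis, phrased with \<open>tl bs\<close>,
      omits.\<close>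
    have "set bs = insert (hd bs) (set (tl bs))"
      using False by (cases bs) auto
    then show ?thesis
      using 1 False by (auto simp: zs insert_commute)
  qed (auto simp: insert_commute)
qed auto

text \<open>Induction removes two vertices of \<open>as\<close> at a time. Distinctness of edges is
  not tracked: \<open>length ws\<close> is the number of edges walked, and that count is compared
  with the size of the edge set afterwards.\<close>

lemma bip_circuit_list:
  assumes "even (length as)" and "even (length bs)" and "bs \<noteq> []"
  shows "\<exists>ws. last (hd bs # ws) = hd bs \<and> set ws \<subseteq> set as \<union> set bs \<and>
    length ws = length as * length bs \<and>
    set (walk_edges (hd bs # ws)) = bip_edges (set as) (set bs)"
  using assms(1)
proof (induction as rule: induct_list012)
  case 1
  show ?case
    by (rule exI[of _ "[]"]) (simp add: bip_edges_def)
next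
  case (3 a a' as)
  let ?b = "hd bs"
  obtain ws where ws: "last (?b # ws) = ?b" "set ws \<subseteq> set as \<union> set bs"
    "length ws = length as * length bs"
    "set (walk_edges (?b # ws)) = bip_edges (set as) (set bs)"
    using 3 by auto
  obtain zs where zs: "zigzag a a' bs = ?b # zs"
    using hd_zigzag[OF assms(2,3), of a a'] zigzag_eq_Nil[OF assms(2), of a a'] assms(3)
    by (cases "zigzag a a' bs") auto
  have b: "insert ?b (set (tl bs)) = set bs"
    using assms(3) by (cases bs) auto
  \<comment> \<open>The second \<open>?b\<close> both closes the tour through \<open>a\<close>,
    \<open>a'\<close> and starts the walk from the induction hypothesis.\<close>
  have "set (walk_edges (?b # zs @ ?b # ws)) =
      set (walk_edges (zigzag a a' bs @ [?b])) \<union> bip_edges (set as) (set bs)"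
    using walk_edges_append[of "zigzag a a' bs" ?b ws] ws(4) by (simp add: zs)
  also have "\<dots> = bip_edges (set (a # a' # as)) (set bs)"
    by (simp only: set_walk_edges_zigzag[OF assms(2,3)] b list.set bip_edges_insert Un_assoc)
  finally have "set (walk_edges (?b # zs @ ?b # ws)) = bip_edges (set (a # a' # as)) (set bs)" .
  moreover have "length (zs @ ?b # ws) = length (a # a' # as) * length bs"
    using length_zigzag[OF assms(2), of a a'] ws(3) by (simp add: zs)
  moreover have "set (zs @ ?b # ws) \<subseteq> set (a # a' # as) \<union> set bs"
    using set_zigzag[of a a' bs] ws(2) assms(3) by (auto simp: zs)
  ultimately show ?case
    using ws(1) by (intro exI[of _ "zs @ ?b # ws"]) simp
qed auto

lemma bip_eulerian_circuit:
  assumes "finite A" "finite B" "A \<inter> B = {}" "B \<noteq> {}" "even (card A)" "even (card B)"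
  shows "\<exists>vs. eulerian_circuit (A \<union> B) (bip_edges A B) vs"
proof -
  obtain as bs where as: "set as = A" "distinct as" and bs: "set bs = B" "distinct bs"
    using assms(1,2) finite_distinct_list by metis
  have len: "length as = card A" "length bs = card B" "bs \<noteq> []"
    using as bs assms(4) distinct_card by force+
  obtain ws where ws: "last (hd bs # ws) = hd bs" "set ws \<subseteq> A \<union> B"
    "length ws = card A * card B" "set (walk_edges (hd bs # ws)) = bip_edges A B"
    using bip_circuit_list[of as bs] len as bs assms(5,6) by auto
  \<comment> \<open>The walk has as many steps as the graph has edges and covers them all, so none
    is repeated.\<close>
  have "distinct (walk_edges (hd bs # ws))"
    by (rule card_distinct) (simp add: ws(3,4) card_bip_edges[OF assms(3)])
  moreover have "hd bs \<in> B"
    using len(3) bs(1) by auto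
  ultimately show ?thesis
    using ws unfolding eulerian_circuit_def closed_trail_def graph_walk_def
    by (intro exI[of _ "hd bs # ws"]) auto
qed

lemma bip_connected:
  assumes "A \<noteq> {}" "B \<noteq> {}"
  shows "graph_connected (A \<union> B) (bip_edges A B)"
  unfolding graph_connected_def
proof (intro ballI)
  fix u v
  assume uv: "u \<in> A \<union> B" "v \<in> A \<union> B"
  obtain a b where ab: "a \<in> A" "b \<in> B"
    using assms by blast
  have e: "{x, y} \<in> bip_edges A B" "{y, x} \<in> bip_edges A B" if "x \<in> A" "y \<in> B" for x y
    using that by (auto simp: bip_edges_def insert_commute image_iff)
  consider "u \<in> A" "v \<in> A" | "u \<in> A" "v \<in> B" | "u \<in> B" "v \<in> A" | "u \<in> B" "v \<in> B"
    using uv by blast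
  then show "\<exists>vs. graph_walk (A \<union> B) (bip_edges A B) vs \<and> hd vs = u \<and> last vs = v"
  proof cases
    \<comment> \<open>Walks may revisit vertices, so the detour through \<open>b\<close> also serves
      when \<open>u = v\<close>.\<close>
    case 1
    then show ?thesis
      using ab e by (intro exI[of _ "[u, b, v]"]) (auto simp: graph_walk_def)
  next
    case 2
    then show ?thesis
      using e by (intro exI[of _ "[u, v]"]) (auto simp: graph_walk_def)
  next
    case 3
    then show ?thesis
      using e by (intro exI[of _ "[u, v]"]) (auto simp: graph_walk_def)
  next
    case 4
    then show ?thesis
      using ab e by (intro exI[of _ "[u, a, v]"]) (auto simp: graph_walk_def)
  qed
qed

theorem bip_eulerian_iff:
  assumes "finite A" "finite B" "A \<inter> B = {}" "A \<noteq> {}" "B \<noteq> {}"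
  shows "eulerian_graph (A \<union> B) (bip_edges A B) \<longleftrightarrow> even (card A) \<and> even (card B)"
proof
  assume "eulerian_graph (A \<union> B) (bip_edges A B)"
  then obtain vs where vs: "eulerian_circuit (A \<union> B) (bip_edges A B) vs"
    by (auto simp: eulerian_graph_def)
  have "{u} \<notin> bip_edges A B" for u
    using assms(3) by (auto simp: bip_edges_def)
  then have ev: "even (card {e \<in> bip_edges A B. v \<in> e})" for v
    using eulerian_circuit_even_degree[OF vs] by blast
  \<comment> \<open>The degree of \<open>a\<close> is \<open>card B\<close> and that of
    \<open>b\<close> is \<open>card A\<close>, so one vertex from each side suffices.\<close>
  obtain a b where ab: "a \<in> A" "b \<in> B"
    using assms(4,5) by blast
  have "B \<inter> A = {}"
    using assms(3) by blast
  then have "card {e \<in> bip_edges A B. b \<in> e} = card A"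
    using bip_degree[of B A b] ab(2) unfolding bip_edges_commute[of B A] by blast
  then show "even (card A) \<and> even (card B)"
    using ev[of a] ev[of b] bip_degree[OF assms(3) ab(1)] by metis
next
  assume ev: "even (card A) \<and> even (card B)"
  obtain a b where "a \<in> A" "b \<in> B"
    using assms(4,5) by blast
  with assms(3) have "\<exists>u\<in>A \<union> B. \<exists>v\<in>A \<union> B. u \<noteq> v"
    by (metis UnI1 UnI2 disjoint_iff)
  moreover obtain vs where "eulerian_circuit (A \<union> B) (bip_edges A B) vs"
    using bip_eulerian_circuit[OF assms(1-3,5)] ev by metis
  ultimately show "eulerian_graph (A \<union> B) (bip_edges A B)"
    using bip_connected[OF assms(4,5)] unfolding eulerian_graph_def by metis
qed

section \<open>Finite local rings\<close>

text \<open>Finiteness replaces Zorn's lemma: among the finitely many proper ideals, those without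
  \<open>\<one>\<close>, choose a maximal one above \<open>I\<close>.\<close>

lemma (in ring) maximalideal_above:
  assumes "finite (carrier R)" "ideal I R" "\<one> \<notin> I"
  shows "\<exists>M. maximalideal M R \<and> I \<subseteq> M"
proof -
  let ?S = "{J. ideal J R \<and> \<one> \<notin> J}"
  have "?S \<subseteq> Pow (carrier R)"
    using ideal.Icarr by fastforce
  then have "finite ?S"
    using assms(1) finite_subset by blast
  then obtain M where M: "ideal M R" "\<one> \<notin> M" "I \<subseteq> M" "\<And>J. J \<in> ?S \<Longrightarrow> M \<subseteq> J \<Longrightarrow> M = J"
    using finite_has_maximal2[of ?S I] assms(2,3) by auto
  have "maximalideal M R"
  proof (rule maximalidealI)
    show "carrier R \<noteq> M"
      using M(2) by auto
    show "J = M \<or> J = carrier R" if "ideal J R" "M \<subseteq> J" for J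
      using M(4)[of J] that ideal.one_imp_carrier by blast
  qed (fact M(1))
  with M(3) show ?thesis
    by blast
qed

lemma (in cring) Units_iff_one_mem_cgenideal:
  assumes "a \<in> carrier R"
  shows "a \<in> Units R \<longleftrightarrow> \<one> \<in> PIdl a"
  using assms m_comm by (auto simp: Units_def cgenideal_def) metis+

text \<open>A nonunit generates a proper ideal, which lies in some maximal ideal and so in the
  unique one; a unit lies in no proper ideal.\<close>

lemma (in local_cring) maximalideal_nonunits:
  assumes "finite (carrier R)"
  shows "maximalideal (carrier R - Units R) R"
proof -
  obtain M where M: "maximalideal M R" and uniq: "\<And>N. maximalideal N R \<Longrightarrow> N = M"
    using unique_maximalideal by blast
  interpret M: maximalideal M R
    by (fact M)
  have "a \<notin> M" if "a \<in> Units R" for a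
    using that M.I_l_closed[of a "inv a"] M.one_imp_carrier M.I_notcarr by auto
  moreover have "a \<in> M" if a: "a \<in> carrier R" "a \<notin> Units R" for a
    using maximalideal_above[OF assms cgenideal_ideal[OF a(1)]] uniq
      Units_iff_one_mem_cgenideal[OF a(1)] a(2) cgenideal_self[OF a(1)] by blast
  ultimately have "M = carrier R - Units R"
    using M.Icarr by blast
  with M show ?thesis
    by simp
qed

text \<open>Multiplication by a nonunit misses \<open>\<one>\<close>, so on a finite carrier it is
  not injective either, and the difference of two colliding elements is annihilated. In the zero
  ring zero is both a unit and a zero divisor.\<close>

lemma (in cring) zero_divisors_eq_nonunits:
  assumes "finite (carrier R)" "\<one> \<noteq> \<zero>"
  shows "zero_divisors R = carrier R - Units R"
proof (intro equalityI subsetI)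
  fix x
  assume x: "x \<in> zero_divisors R"
  show "x \<in> carrier R - Units R"
  proof
    show "x \<in> carrier R"
      using x by (auto simp: zero_divisors_def)
    show "x \<notin> Units R"
    proof
      assume u: "x \<in> Units R"
      \<comment> \<open>If \<open>x\<close> is a zero divisor only by the convention for
        \<open>\<zero>\<close>, the witness is \<open>\<one>\<close>.\<close>
      obtain y where y: "y \<in> carrier R" "y \<noteq> \<zero>" "x \<otimes> y = \<zero>"
        using x assms(2) one_closed that[of \<one>] by (auto simp: zero_divisors_def)
      have "x \<otimes> y = x \<otimes> \<zero>"
        using y(3) u by (simp add: Units_closed)
      then show False
        using u y(1,2) by (subst (asm) Units_l_cancel) auto
    qed
  qed
next
  fix x
  assume x: "x \<in> carrier R - Units R"
  let ?f = "\<lambda>y. x \<otimes> y"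
  have "\<one> \<notin> ?f ` carrier R"
    using x m_comm by (auto simp: Units_def)
  then have "?f ` carrier R \<noteq> carrier R"
    by auto
  moreover have "?f ` carrier R \<subseteq> carrier R"
    using x by auto
  ultimately have "\<not> inj_on ?f (carrier R)"
    using endo_inj_surj[OF assms(1)] by blast
  then obtain y z where yz: "y \<in> carrier R" "z \<in> carrier R" "y \<noteq> z" "x \<otimes> y = x \<otimes> z"
    by (auto simp: inj_on_def)
  then have "x \<otimes> (y \<ominus> z) = \<zero>"
    using x by (simp add: a_minus_def r_distr r_minus r_neg)
  moreover have "y \<ominus> z \<noteq> \<zero>"
    using yz by simp
  ultimately show "x \<in> zero_divisors R"
    using x minus_closed[OF yz(1,2)] unfolding zero_divisors_def by blast
qed

lemma (in local_cring) uz_edges_eq_bip_edges: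
  assumes "finite (carrier R)"
  shows "uz_edges R = bip_edges (carrier R - Units R) (Units R)"
proof -
  interpret M: maximalideal "carrier R - Units R" R
    by (rule maximalideal_nonunits[OF assms])
  interpret P: primeideal "carrier R - Units R" R
    by (rule maximalideal_prime[OF M.is_maximalideal])
  have zM: "\<zero> \<in> carrier R - Units R"
    by (rule M.zero_closed)
  then have "\<one> \<noteq> \<zero>"
    using Units_one_closed by force
  then have Z: "zero_divisors R = carrier R - Units R"
    by (rule zero_divisors_eq_nonunits[OF assms])
  have mixed: "u \<oplus> v \<in> Units R" if u: "u \<in> carrier R - Units R" and v: "v \<in> Units R" for u v
  proof (rule ccontr)
    assume "u \<oplus> v \<notin> Units R"
    then have "u \<oplus> v \<in> carrier R - Units R"
      using u v by auto
    \<comment> \<open>Subtracting \<open>u\<close> within the ideal of nonunits would put the unit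
      \<open>v\<close> into it.\<close>
    then have "\<ominus> u \<oplus> (u \<oplus> v) \<in> carrier R - Units R"
      using u by (metis M.a_closed M.a_inv_closed)
    then show False
      using u v by (simp add: r_neg1 Units_closed)
  qed
  \<comment> \<open>Two units fail by their product, a unit; two nonunits fail by their sum, which
    stays in the ideal. A mixed pair has its product in the ideal by absorption and its sum a unit
    by \<open>mixed\<close>.\<close>
  have adj: "u \<oplus> v \<in> Units R \<and> u \<otimes> v \<in> zero_divisors R \<longleftrightarrow> (u \<in> Units R) \<noteq> (v \<in> Units R)"
    if uv: "u \<in> carrier R" "v \<in> carrier R" for u v
  proof (cases "u \<in> Units R"; cases "v \<in> Units R")
    assume "u \<in> Units R" "v \<in> Units R"
    then show ?thesis
      by (simp add: Z)
  next
    assume "u \<in> Units R" "v \<notin> Units R"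
    then show ?thesis
      using uv mixed[of v u] M.I_l_closed[of v u] by (simp add: Z a_comm)
  next
    assume "u \<notin> Units R" "v \<in> Units R"
    then show ?thesis
      using uv mixed[of u v] M.I_r_closed[of u v] by (simp add: Z)
  next
    assume "u \<notin> Units R" "v \<notin> Units R"
    then show ?thesis
      using uv M.a_closed[of u v] by simp
  qed
  show ?thesis
  proof (intro equalityI subsetI)
    fix e
    assume "e \<in> uz_edges R"
    then obtain u v where "e = {u, v}" "u \<in> carrier R" "v \<in> carrier R"
      "(u \<in> Units R) \<noteq> (v \<in> Units R)"
      using adj by (auto simp: uz_edges_def)
    then show "e \<in> bip_edges (carrier R - Units R) (Units R)"
      by (cases "u \<in> Units R") (auto simp: bip_edges_def image_iff insert_commute)
  next
    fix e
    assume "e \<in> bip_edges (carrier R - Units R) (Units R)"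
    then obtain u v where "e = {u, v}" "u \<in> carrier R - Units R" "v \<in> Units R"
      by (auto simp: bip_edges_def)
    moreover from this have "v \<in> carrier R" "u \<noteq> v"
      by auto
    ultimately show "e \<in> uz_edges R"
      using adj[of u v] unfolding uz_edges_def by blast
  qed
qed

theorem theorem3p8:
  fixes R :: "('a, 'b) ring_scheme"
  assumes "local_cring R" and "finite (carrier R)"
  shows "eulerian_graph (carrier R) (uz_edges R) \<longleftrightarrow>
         even (card (carrier R)) \<and> even (card (Units R))"
proof -
  interpret local_cring R
    by (fact assms(1))
  interpret M: maximalideal "carrier R - Units R" R
    by (rule maximalideal_nonunits[OF assms(2)])
  let ?N = "carrier R - Units R"
  have N: "?N \<noteq> {}" "Units R \<noteq> {}" "finite ?N" "finite (Units R)" "?N \<union> Units R = carrier R"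
    using M.zero_closed assms(2) by auto
  \<comment> \<open>Once \<open>card (Units R)\<close> is even, this sum turns evenness of
    \<open>card ?N\<close> into evenness of \<open>card (carrier R)\<close> and back.\<close>
  have "card (carrier R) = card ?N + card (Units R)"
    using card_Un_disjoint[OF N(3,4)] N(5) by auto
  then show ?thesis
    using bip_eulerian_iff[of ?N "Units R"] N uz_edges_eq_bip_edges[OF assms(2)] by auto
qed

end
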